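(* Let $\mathcal{N}=\{1,\dots,n\}$ and let $\Delta$ be a nonnegative integer. For any $\bm{a},\bm{b}\in\mathbb{R}^n_+$, the linear program \begin{align*} \min\ & \sum_{i\in\mathcal{N}}\sum_{j\in\mathcal{N}} a_ib_j\,y_{ij}\\ \text{s.t. } & \sum_{i\in\mathcal{N}} y_{ij}=1 \quad \forall j\in\mathcal{N},\\ & \sum_{j\in\mathcal{N}} y_{ij}=1 \quad \forall i\in\mathcal{N},\\ & y_{ij}=y_{ji} \quad \forall i,j\in\mathcal{N},\\ & \sum_{i\in\mathcal{N}} y_{ii}\ge n-2\Delta,\\ & y_{ij}\ge 0 \quad \forall i,j\in\mathcal{N} \end{align*} has an optimal solution with $y_{ij}\in\{0,1\}$ for all $i,j\in\mathcal{N}$.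
   Context: $\mathbb{R}_+$ denotes the nonnegative reals. The variables are $y_{ij}\in\mathbb{R}$, $i,j\in\mathcal{N}$. *)

theory Defs
  imports Complex_Main
begin

text \<open>
  Vectors and matrices are functions on \<^typ>\<open>nat\<close>, of which only the values at indices
  in \<open>{1..n}\<close> matter.
\<close>

definition lp_cost :: "nat \<Rightarrow> (nat \<Rightarrow> real) \<Rightarrow> (nat \<Rightarrow> real) \<Rightarrow> (nat \<Rightarrow> nat \<Rightarrow> real) \<Rightarrow> real" where
  "lp_cost n a b y = (\<Sum>i\<in>{1..n}. \<Sum>j\<in>{1..n}. a i * b j * y i j)"

definition lp_feasible :: "nat \<Rightarrow> nat \<Rightarrow> (nat \<Rightarrow> nat \<Rightarrow> real) \<Rightarrow> bool" where
  "lp_feasible n \<Delta> y \<longleftrightarrow>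
     (\<forall>j\<in>{1..n}. (\<Sum>i\<in>{1..n}. y i j) = 1) \<and>
     (\<forall>i\<in>{1..n}. (\<Sum>j\<in>{1..n}. y i j) = 1) \<and>
     (\<forall>i\<in>{1..n}. \<forall>j\<in>{1..n}. y i j = y j i) \<and>
     (\<Sum>i\<in>{1..n}. y i i) \<ge> real n - 2 * real \<Delta> \<and>
     (\<forall>i\<in>{1..n}. \<forall>j\<in>{1..n}. y i j \<ge> 0)"

definition lp_optimal ::
  "nat \<Rightarrow> nat \<Rightarrow> (nat \<Rightarrow> real) \<Rightarrow> (nat \<Rightarrow> real) \<Rightarrow> (nat \<Rightarrow> nat \<Rightarrow> real) \<Rightarrow> bool" where
  "lp_optimal n \<Delta> a b y \<longleftrightarrow>
     lp_feasible n \<Delta> y \<and> (\<forall>z. lp_feasible n \<Delta> z \<longrightarrow> lp_cost n a b y \<le> lp_cost n a b z)"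

end

theory Submission
  imports Defs
begin

text \<open>
  A feasible \<open>y\<close> is a fractional matching with at most \<open>\<Delta>\<close> edges, where matching \<open>i\<close> with \<open>j\<close>
  saves \<open>w i j = (a j - a i) * (b j - b i)\<close> over the identity. Only pairs with \<open>a i < a j\<close> and
  \<open>b i < b j\<close> are worth matching; they form a strict partial order on which \<open>w\<close> is superadditive.
  Mass on consecutive pairs \<open>i < j < k\<close> can therefore be moved to \<open>(i, k)\<close> without loss, until no
  vertex is both an upper and a lower end of an edge. The support is then bipartite, and a
  fractional bipartite matching can be rounded without loss within its cardinality bound.
\<close>

section \<open>Rounding a real matrix with integral row and column sums\<close>

text \<open>Gaussian elimination, by induction on the equations: an equation whose coefficients all
  vanish is dropped; any other one is solved for a pivot unknown \<open>p\<close>, which leaves one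
  equation and one unknown fewer.\<close>

lemma underdetermined_system_nontrivial_solution:
  fixes A :: "'c \<Rightarrow> 'e \<Rightarrow> 'a::field"
  assumes "finite C" "finite F" "card C < card F"
  shows "\<exists>d. (\<exists>e\<in>F. d e \<noteq> 0) \<and> (\<forall>c\<in>C. (\<Sum>e\<in>F. A c e * d e) = 0)"
  using assms
proof (induction C arbitrary: F A rule: finite_induct)
  case empty
  then have "F \<noteq> {}" by auto
  then show ?case by (intro exI[of _ "\<lambda>_. 1"]) auto
next
  case (insert c C)
  show ?case
  proof (cases "\<forall>e\<in>F. A c e = 0")
    case True
    have "card C < card F" using insert by simp
    with insert.IH[OF insert.prems(1), of A] obtain d
      where "\<exists>e\<in>F. d e \<noteq> 0" "\<forall>c\<in>C. (\<Sum>e\<in>F. A c e * d e) = 0" by blast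
    then show ?thesis using True by (intro exI[of _ d]) auto
  next
    case False
    then obtain p where p: "p \<in> F" "A c p \<noteq> 0" by blast
    define G where "G = F - {p}"
    have G: "finite G" "card C < card G" "p \<notin> G" "F = insert p G"
      using insert p by (auto simp: G_def card_Diff_singleton)
    \<comment> \<open>The coefficients of equation \<open>c'\<close> after eliminating
      \<open>p\<close> by means of equation \<open>c\<close>.\<close>
    from insert.IH[OF G(1,2), of "\<lambda>c' e. A c' e - A c' p * A c e / A c p"]
    obtain d where d: "\<exists>e\<in>G. d e \<noteq> 0"
      "\<forall>c'\<in>C. (\<Sum>e\<in>G. (A c' e - A c' p * A c e / A c p) * d e) = 0" by blast
    \<comment> \<open>Back substitution: the value at \<open>p\<close> that makes equation
      \<open>c\<close> hold.\<close>
    define q where "q = - (\<Sum>e\<in>G. A c e * d e) / A c p"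
    have *: "(\<Sum>e\<in>F. A c' e * (d(p := q)) e) = A c' p * q + (\<Sum>e\<in>G. A c' e * d e)" for c'
    proof -
      have "(\<Sum>e\<in>G. A c' e * (d(p := q)) e) = (\<Sum>e\<in>G. A c' e * d e)"
        by (rule sum.cong) (use G in auto)
      then show ?thesis using G by simp
    qed
    have "(\<Sum>e\<in>F. A c' e * (d(p := q)) e) = 0" if "c' \<in> insert c C" for c'
    proof (cases "c' = c")
      case True
      then show ?thesis using *[of c] p(2) by (simp add: q_def del: fun_upd_apply)
    next
      case False
      then have "0 = (\<Sum>e\<in>G. (A c' e - A c' p * A c e / A c p) * d e)" using d that by simp
      also have "\<dots> = (\<Sum>e\<in>G. A c' e * d e) - A c' p / A c p * (\<Sum>e\<in>G. A c e * d e)"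
        by (simp add: sum_distrib_left sum_subtractf algebra_simps)
      finally show ?thesis using *[of c'] by (simp add: q_def del: fun_upd_apply)
    qed
    moreover have "\<exists>e\<in>F. (d(p := q)) e \<noteq> 0" using d(1) G by auto
    ultimately show ?thesis by blast
  qed
qed

lemma another_fractional_summand:
  fixes f :: "'a \<Rightarrow> real"
  assumes "finite C" "sum f C \<in> \<int>" "j \<in> C" "f j \<notin> \<int>"
  shows "\<exists>k\<in>C. k \<noteq> j \<and> f k \<notin> \<int>"
proof (rule ccontr)
  assume "\<not> ?thesis"
  then have "sum f (C - {j}) \<in> \<int>" by (intro Ints_sum) auto
  moreover have "f j = sum f C - sum f (C - {j})" using assms by (simp add: sum.remove)
  ultimately show False using assms by (metis Ints_diff)
qed

text \<open>\<open>F\<close> is counted fibre by fibre. With \<open>f\<close> a projection, this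
  bounds the number of rows or columns that contain a fractional entry.\<close>

lemma card_image_fibres_ge_2:
  assumes "finite F" "\<And>e. e \<in> F \<Longrightarrow> \<exists>e'\<in>F. e' \<noteq> e \<and> f e' = f e"
  shows "2 * card (f ` F) \<le> card F"
proof -
  have "2 \<le> card {e\<in>F. f e = u}" if "u \<in> f ` F" for u
  proof -
    from that obtain e where "e \<in> F" "f e = u" by blast
    moreover from this assms(2) obtain e' where "e' \<in> F" "e' \<noteq> e" "f e' = u" by metis
    ultimately have "card {e, e'} \<le> card {e\<in>F. f e = u}"
      using assms(1) by (intro card_mono) auto
    then show ?thesis using \<open>e' \<noteq> e\<close> by simp
  qed
  then have "(\<Sum>u\<in>f ` F. 2) \<le> (\<Sum>u\<in>f ` F. card {e\<in>F. f e = u})" by (intro sum_mono)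
  also have "\<dots> = card F" using sum.image_gen[OF assms(1), of "\<lambda>_. 1::nat" f] by simp
  finally show ?thesis by simp
qed

text \<open>The fractional entries are the unknowns; every row or column containing one gives an
  equation. An integral sum cannot have exactly one fractional summand, so each such row or column
  contains at least two unknowns. Hence there are at most as many equations as unknowns, and one
  equation is redundant.\<close>

lemma zero_margin_perturbation:
  fixes x :: "'r \<Rightarrow> 'c \<Rightarrow> real"
  assumes R: "finite R" and C: "finite C"
    and rows: "\<And>i. i \<in> R \<Longrightarrow> (\<Sum>j\<in>C. x i j) \<in> \<int>"
    and cols: "\<And>j. j \<in> C \<Longrightarrow> (\<Sum>i\<in>R. x i j) \<in> \<int>"
    and frac: "i0 \<in> R" "j0 \<in> C" "x i0 j0 \<notin> \<int>"
  shows "\<exists>d. (\<exists>i\<in>R. \<exists>j\<in>C. d i j \<noteq> 0) \<and> (\<forall>i\<in>R. \<forall>j\<in>C. x i j \<in> \<int> \<longrightarrow> d i j = 0) \<and>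
    (\<forall>i\<in>R. (\<Sum>j\<in>C. d i j) = 0) \<and> (\<forall>j\<in>C. (\<Sum>i\<in>R. d i j) = (0::real))"
proof -
  define F where "F = {e \<in> R \<times> C. x (fst e) (snd e) \<notin> \<int>}"
  have F: "finite F" "(i0, j0) \<in> F" "F \<subseteq> R \<times> C" using R C frac by (auto simp: F_def)
  have r: "2 * card (fst ` F) \<le> card F"
  proof (rule card_image_fibres_ge_2[OF F(1)])
    fix e assume "e \<in> F"
    then have e: "fst e \<in> R" "snd e \<in> C" "x (fst e) (snd e) \<notin> \<int>" by (auto simp: F_def)
    from another_fractional_summand[OF C rows[OF e(1)] e(2,3)]
    obtain k where "k \<in> C" "k \<noteq> snd e" "x (fst e) k \<notin> \<int>" by blast
    then show "\<exists>e'\<in>F. e' \<noteq> e \<and> fst e' = fst e" using e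
      by (intro bexI[of _ "(fst e, k)"]) (cases e, auto simp: F_def)
  qed
  have c: "2 * card (snd ` F) \<le> card F"
  proof (rule card_image_fibres_ge_2[OF F(1)])
    fix e assume "e \<in> F"
    then have e: "fst e \<in> R" "snd e \<in> C" "x (fst e) (snd e) \<notin> \<int>" by (auto simp: F_def)
    from another_fractional_summand[OF R cols[OF e(2)] e(1), OF e(3)]
    obtain k where "k \<in> R" "k \<noteq> fst e" "x k (snd e) \<notin> \<int>" by blast
    then show "\<exists>e'\<in>F. e' \<noteq> e \<and> snd e' = snd e" using e
      by (intro bexI[of _ "(k, snd e)"]) (cases e, auto simp: F_def)
  qed
  \<comment> \<open>The zero-sum condition on row \<open>i0\<close> is omitted: it follows from the others, and without it
    there are fewer conditions than unknowns.\<close>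
  define K where "K = Inl ` (fst ` F - {i0}) \<union> Inr ` (snd ` F)"
  define A :: "'r + 'c \<Rightarrow> 'r \<times> 'c \<Rightarrow> real" where
    "A k e = (case k of Inl i \<Rightarrow> of_bool (fst e = i) | Inr j \<Rightarrow> of_bool (snd e = j))" for k e
  have "i0 \<in> fst ` F" using F(2) by force
  then have "card (fst ` F - {i0}) < card (fst ` F)" using F(1) by (intro card_Diff1_less) auto
  moreover have "card K \<le> card (fst ` F - {i0}) + card (snd ` F)"
    unfolding K_def using card_Un_le[of "Inl ` (fst ` F - {i0})" "Inr ` (snd ` F)"]
    by (simp add: card_image)
  ultimately have "card K < card F" using r c by linarith
  moreover have "finite K" using F by (auto simp: K_def)
  ultimately obtain d where d: "\<exists>e\<in>F. d e \<noteq> 0" "\<forall>k\<in>K. (\<Sum>e\<in>F. A k e * d e) = 0"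
    using underdetermined_system_nontrivial_solution[of K F A] F by blast
  \<comment> \<open>Extension by zero outside \<open>F\<close>, which turns the equations over
    \<open>F\<close> into sums over whole rows and columns.\<close>
  define D where "D i j = (if (i, j) \<in> F then d (i, j) else 0)" for i j
  have ext: "(\<Sum>e\<in>F. g e * d e) = (\<Sum>i\<in>R. \<Sum>j\<in>C. g (i, j) * D i j)" for g
  proof -
    have "(\<Sum>e\<in>F. g e * d e) = (\<Sum>e\<in>R \<times> C. g e * D (fst e) (snd e))"
      by (rule sum.mono_neutral_cong_left) (use R C F in \<open>auto simp: D_def\<close>)
    then show ?thesis by (simp add: sum.cartesian_product case_prod_unfold)
  qed
  have row: "(\<Sum>e\<in>F. A (Inl i) e * d e) = (\<Sum>j\<in>C. D i j)" if "i \<in> R" for i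
  proof -
    have "(\<Sum>e\<in>F. A (Inl i) e * d e) = (\<Sum>i'\<in>R. if i' = i then \<Sum>j\<in>C. D i' j else 0)"
      unfolding ext by (rule sum.cong) (auto simp: A_def)
    then show ?thesis using that R by simp
  qed
  have col: "(\<Sum>e\<in>F. A (Inr j) e * d e) = (\<Sum>i\<in>R. D i j)" if "j \<in> C" for j
  proof -
    have "(\<Sum>e\<in>F. A (Inr j) e * d e) = (\<Sum>j'\<in>C. if j' = j then \<Sum>i\<in>R. D i j' else 0)"
      unfolding ext by (subst sum.swap, rule sum.cong) (auto simp: A_def)
    then show ?thesis using that C by simp
  qed
  have col0: "(\<Sum>i\<in>R. D i j) = 0" if "j \<in> C" for j
  proof (cases "j \<in> snd ` F")
    case True
    then show ?thesis using d(2) col[OF that] by (auto simp: K_def)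
  next
    case False
    then have "D i j = 0" for i by (force simp: D_def)
    then show ?thesis by simp
  qed
  have row0': "(\<Sum>j\<in>C. D i j) = 0" if "i \<in> R" "i \<noteq> i0" for i
  proof (cases "i \<in> fst ` F")
    case True
    then have "Inl i \<in> K" using that by (simp add: K_def)
    then show ?thesis using d(2) row[OF that(1)] by simp
  next
    case False
    then have "D i j = 0" for j by (force simp: D_def)
    then show ?thesis by simp
  qed
  \<comment> \<open>The omitted equation is recovered: the total of \<open>D\<close> vanishes when
    taken by columns, and all rows other than \<open>i0\<close> sum to zero.\<close>
  have "(\<Sum>i\<in>R. \<Sum>j\<in>C. D i j) = (\<Sum>j\<in>C. \<Sum>i\<in>R. D i j)" by (rule sum.swap)
  then have "(\<Sum>i\<in>R. \<Sum>j\<in>C. D i j) = 0" using col0 by simp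
  then have "(\<Sum>j\<in>C. D i0 j) = 0" using row0' R frac(1) by (simp add: sum.remove[of R i0])
  then have "\<forall>i\<in>R. (\<Sum>j\<in>C. D i j) = 0" using row0' by metis
  moreover have "\<exists>i\<in>R. \<exists>j\<in>C. D i j \<noteq> 0" using d(1) F(3) by (force simp: D_def)
  moreover have "\<forall>i\<in>R. \<forall>j\<in>C. x i j \<in> \<int> \<longrightarrow> D i j = 0" by (auto simp: D_def F_def)
  ultimately show ?thesis using col0 by blast
qed

text \<open>From \<open>x\<close> one moves along a perturbation with zero margins until the first
  entry hits the floor or ceiling of its old value. Integral entries do not move, so the set of
  fractional entries strictly shrinks.\<close>

lemma fewer_fractional_entries:
  fixes x c :: "'r \<Rightarrow> 'c \<Rightarrow> real"
  assumes R: "finite R" and C: "finite C"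
    and rows: "\<And>i. i \<in> R \<Longrightarrow> (\<Sum>j\<in>C. x i j) \<in> \<int>"
    and cols: "\<And>j. j \<in> C \<Longrightarrow> (\<Sum>i\<in>R. x i j) \<in> \<int>"
    and frac: "i0 \<in> R" "j0 \<in> C" "x i0 j0 \<notin> \<int>"
  shows "\<exists>z. (\<forall>i\<in>R. \<forall>j\<in>C. of_int \<lfloor>x i j\<rfloor> \<le> z i j \<and> z i j \<le> of_int \<lceil>x i j\<rceil>) \<and>
    (\<forall>i\<in>R. (\<Sum>j\<in>C. z i j) = (\<Sum>j\<in>C. x i j)) \<and>
    (\<forall>j\<in>C. (\<Sum>i\<in>R. z i j) = (\<Sum>i\<in>R. x i j)) \<and>
    (\<Sum>i\<in>R. \<Sum>j\<in>C. c i j * z i j) \<le> (\<Sum>i\<in>R. \<Sum>j\<in>C. c i j * x i j) \<and>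
    {e \<in> R \<times> C. z (fst e) (snd e) \<notin> \<int>} \<subset> {e \<in> R \<times> C. x (fst e) (snd e) \<notin> \<int>}"
proof -
  obtain d0 :: "'r \<Rightarrow> 'c \<Rightarrow> real" where d0: "\<exists>i\<in>R. \<exists>j\<in>C. d0 i j \<noteq> 0"
    "\<forall>i\<in>R. \<forall>j\<in>C. x i j \<in> \<int> \<longrightarrow> d0 i j = 0"
    "\<forall>i\<in>R. (\<Sum>j\<in>C. d0 i j) = 0" "\<forall>j\<in>C. (\<Sum>i\<in>R. d0 i j) = 0"
    using zero_margin_perturbation[OF assms] by blast
  \<comment> \<open>Both \<open>d0\<close> and its negative preserve the margins; the sign is chosen
    so that the cost does not increase.\<close>
  define s :: real where "s = (if (\<Sum>i\<in>R. \<Sum>j\<in>C. c i j * d0 i j) \<le> 0 then 1 else - 1)"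
  define d where "d i j = s * d0 i j" for i j
  have s: "s \<noteq> 0" by (simp add: s_def)
  have d: "\<exists>i\<in>R. \<exists>j\<in>C. d i j \<noteq> 0" "\<forall>i\<in>R. \<forall>j\<in>C. x i j \<in> \<int> \<longrightarrow> d i j = 0"
    "\<forall>i\<in>R. (\<Sum>j\<in>C. d i j) = 0" "\<forall>j\<in>C. (\<Sum>i\<in>R. d i j) = 0"
    using d0 s by (simp_all add: d_def flip: sum_distrib_left)
  have "(\<Sum>i\<in>R. \<Sum>j\<in>C. c i j * d i j) = s * (\<Sum>i\<in>R. \<Sum>j\<in>C. c i j * d0 i j)"
    by (simp add: d_def sum_distrib_left algebra_simps)
  then have cost: "(\<Sum>i\<in>R. \<Sum>j\<in>C. c i j * d i j) \<le> 0" by (auto simp: s_def)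
  \<comment> \<open>The step length at which entry \<open>e\<close> reaches the integer ahead of it:
    the ceiling if it grows, the floor if it shrinks.\<close>
  define \<tau> where "\<tau> e = (let u = x (fst e) (snd e); v = d (fst e) (snd e) in
      (if v > 0 then of_int \<lceil>u\<rceil> - u else of_int \<lfloor>u\<rfloor> - u) / v)" for e
  define S where "S = {e \<in> R \<times> C. d (fst e) (snd e) \<noteq> 0}"
  have S: "finite S" "S \<noteq> {}" using R C d(1) by (force simp: S_def)+
  \<comment> \<open>The longest step that respects all bounds; the entry \<open>p\<close> attaining
    the minimum becomes integral.\<close>
  define t where "t = Min (\<tau> ` S)"
  have "t \<in> \<tau> ` S" unfolding t_def using S by (intro Min_in) auto
  then obtain p where p: "p \<in> S" "t = \<tau> p" by blast
  have tle: "t \<le> \<tau> e" if "e \<in> S" for e unfolding t_def using S that by simp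
  have \<tau>0: "0 \<le> \<tau> e" for e
    unfolding \<tau>_def Let_def by (auto simp: divide_simps)
  then have t0: "0 \<le> t" using p by simp
  define z where "z i j = x i j + t * d i j" for i j
  have "of_int \<lfloor>x i j\<rfloor> \<le> z i j \<and> z i j \<le> of_int \<lceil>x i j\<rceil>" if "i \<in> R" "j \<in> C" for i j
  proof -
    consider "d i j = 0" | "d i j > 0" | "d i j < 0" by linarith
    then show ?thesis
    proof cases
      case 1
      then show ?thesis by (simp add: z_def)
    next
      case 2
      then have "(i, j) \<in> S" using that by (simp add: S_def)
      then have "t \<le> (of_int \<lceil>x i j\<rceil> - x i j) / d i j" using tle[of "(i, j)"] 2 by (simp add: \<tau>_def Let_def)
      then have "t * d i j \<le> of_int \<lceil>x i j\<rceil> - x i j" using 2 by (simp add: field_simps)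
      moreover have "0 \<le> t * d i j" using t0 2 by simp
      moreover have "of_int \<lfloor>x i j\<rfloor> \<le> x i j" by simp
      ultimately show ?thesis unfolding z_def by linarith
    next
      case 3
      then have "(i, j) \<in> S" using that by (simp add: S_def)
      then have "t \<le> (of_int \<lfloor>x i j\<rfloor> - x i j) / d i j" using tle[of "(i, j)"] 3 by (simp add: \<tau>_def Let_def)
      then have "t * d i j \<ge> of_int \<lfloor>x i j\<rfloor> - x i j" using 3 by (simp add: field_simps)
      moreover have "t * d i j \<le> 0" using t0 3 by (simp add: mult_nonneg_nonpos)
      moreover have "x i j \<le> of_int \<lceil>x i j\<rceil>" by simp
      ultimately show ?thesis unfolding z_def by linarith
    qed
  qed
  moreover have "(\<Sum>j\<in>C. z i j) = (\<Sum>j\<in>C. x i j)" if "i \<in> R" for i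
    using d(3) that by (simp add: z_def sum.distrib flip: sum_distrib_left)
  moreover have "(\<Sum>i\<in>R. z i j) = (\<Sum>i\<in>R. x i j)" if "j \<in> C" for j
    using d(4) that by (simp add: z_def sum.distrib flip: sum_distrib_left)
  moreover have "(\<Sum>i\<in>R. \<Sum>j\<in>C. c i j * z i j) \<le> (\<Sum>i\<in>R. \<Sum>j\<in>C. c i j * x i j)"
  proof -
    have "(\<Sum>i\<in>R. \<Sum>j\<in>C. c i j * z i j) =
        (\<Sum>i\<in>R. \<Sum>j\<in>C. c i j * x i j) + t * (\<Sum>i\<in>R. \<Sum>j\<in>C. c i j * d i j)"
      by (simp add: z_def sum.distrib sum_distrib_left algebra_simps)
    then show ?thesis using cost t0 by (simp add: mult_nonneg_nonpos)
  qed
  moreover have "{e \<in> R \<times> C. z (fst e) (snd e) \<notin> \<int>} \<subset> {e \<in> R \<times> C. x (fst e) (snd e) \<notin> \<int>}"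
  proof -
    have "z (fst p) (snd p) \<in> \<int>"
      using p by (auto simp: z_def \<tau>_def S_def Let_def)
    moreover have "p \<in> R \<times> C" "x (fst p) (snd p) \<notin> \<int>" using p(1) d(2) by (auto simp: S_def)
    moreover have "x (fst e) (snd e) \<notin> \<int>" if "e \<in> R \<times> C" "z (fst e) (snd e) \<notin> \<int>" for e
      using that d(2) by (auto simp: z_def)
    ultimately show ?thesis by blast
  qed
  ultimately show ?thesis by blast
qed

text \<open>Induction on the number of fractional entries, each round preserving the margins and not
  raising the cost.\<close>

lemma integral_matrix_rounding:
  fixes x c :: "'r \<Rightarrow> 'c \<Rightarrow> real"
  assumes R: "finite R" and C: "finite C"
    and rows: "\<And>i. i \<in> R \<Longrightarrow> (\<Sum>j\<in>C. x i j) \<in> \<int>"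
    and cols: "\<And>j. j \<in> C \<Longrightarrow> (\<Sum>i\<in>R. x i j) \<in> \<int>"
  shows "\<exists>z. (\<forall>i\<in>R. \<forall>j\<in>C. z i j \<in> \<int> \<and> of_int \<lfloor>x i j\<rfloor> \<le> z i j \<and> z i j \<le> of_int \<lceil>x i j\<rceil>) \<and>
    (\<forall>i\<in>R. (\<Sum>j\<in>C. z i j) = (\<Sum>j\<in>C. x i j)) \<and>
    (\<forall>j\<in>C. (\<Sum>i\<in>R. z i j) = (\<Sum>i\<in>R. x i j)) \<and>
    (\<Sum>i\<in>R. \<Sum>j\<in>C. c i j * z i j) \<le> (\<Sum>i\<in>R. \<Sum>j\<in>C. c i j * x i j)"
  using rows cols
proof (induction "card {e \<in> R \<times> C. x (fst e) (snd e) \<notin> \<int>}" arbitrary: x rule: less_induct)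
  case less
  show ?case
  proof (cases "\<exists>i\<in>R. \<exists>j\<in>C. x i j \<notin> \<int>")
    case False
    then show ?thesis by (intro exI[of _ x]) auto
  next
    case True
    then obtain i0 j0 where f: "i0 \<in> R" "j0 \<in> C" "x i0 j0 \<notin> \<int>" by blast
    from fewer_fractional_entries[OF R C less.prems f, of c] obtain y where y:
      "\<forall>i\<in>R. \<forall>j\<in>C. of_int \<lfloor>x i j\<rfloor> \<le> y i j \<and> y i j \<le> of_int \<lceil>x i j\<rceil>"
      "\<forall>i\<in>R. (\<Sum>j\<in>C. y i j) = (\<Sum>j\<in>C. x i j)"
      "\<forall>j\<in>C. (\<Sum>i\<in>R. y i j) = (\<Sum>i\<in>R. x i j)"
      "(\<Sum>i\<in>R. \<Sum>j\<in>C. c i j * y i j) \<le> (\<Sum>i\<in>R. \<Sum>j\<in>C. c i j * x i j)"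
      "{e \<in> R \<times> C. y (fst e) (snd e) \<notin> \<int>} \<subset> {e \<in> R \<times> C. x (fst e) (snd e) \<notin> \<int>}"
      by blast
    have "card {e \<in> R \<times> C. y (fst e) (snd e) \<notin> \<int>} < card {e \<in> R \<times> C. x (fst e) (snd e) \<notin> \<int>}"
      using y(5) R C by (intro psubset_card_mono) auto
    from less.hyps[OF this] y(2,3) less.prems obtain z where z:
      "\<forall>i\<in>R. \<forall>j\<in>C. z i j \<in> \<int> \<and> of_int \<lfloor>y i j\<rfloor> \<le> z i j \<and> z i j \<le> of_int \<lceil>y i j\<rceil>"
      "\<forall>i\<in>R. (\<Sum>j\<in>C. z i j) = (\<Sum>j\<in>C. y i j)"
      "\<forall>j\<in>C. (\<Sum>i\<in>R. z i j) = (\<Sum>i\<in>R. y i j)"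
      "(\<Sum>i\<in>R. \<Sum>j\<in>C. c i j * z i j) \<le> (\<Sum>i\<in>R. \<Sum>j\<in>C. c i j * y i j)"
      by auto
    \<comment> \<open>Bounds survive the recursion: \<open>y i j\<close> lies between two integers,
      the floor and ceiling of \<open>x i j\<close>, and so do its own floor and ceiling.\<close>
    have "of_int \<lfloor>x i j\<rfloor> \<le> z i j \<and> z i j \<le> of_int \<lceil>x i j\<rceil>" if "i \<in> R" "j \<in> C" for i j
    proof -
      have "\<lfloor>x i j\<rfloor> \<le> \<lfloor>y i j\<rfloor>" "\<lceil>y i j\<rceil> \<le> \<lceil>x i j\<rceil>"
        using y(1) that by (simp_all add: le_floor_iff ceiling_le_iff)
      then have "real_of_int \<lfloor>x i j\<rfloor> \<le> of_int \<lfloor>y i j\<rfloor>" "real_of_int \<lceil>y i j\<rceil> \<le> of_int \<lceil>x i j\<rceil>"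
        by simp_all
      then show ?thesis using z(1) that by fastforce
    qed
    then show ?thesis using y z by (intro exI[of _ z]) auto
  qed
qed

section \<open>Fractional matchings on a superadditive order\<close>

text \<open>The mass of an edge is stored at the pair oriented along \<open>P\<close>, from lower to
  upper end. The degree of a vertex therefore adds both orientations, whereas the size is the plain
  sum of all entries.\<close>

definition fractional_matching ::
  "'a set \<Rightarrow> ('a \<Rightarrow> 'a \<Rightarrow> bool) \<Rightarrow> nat \<Rightarrow> ('a \<Rightarrow> 'a \<Rightarrow> real) \<Rightarrow> bool" where
  "fractional_matching V P D x \<longleftrightarrow>
     (\<forall>i\<in>V. \<forall>j\<in>V. 0 \<le> x i j \<and> (x i j \<noteq> 0 \<longrightarrow> P i j)) \<and>
     (\<forall>i\<in>V. (\<Sum>j\<in>V. x i j + x j i) \<le> 1) \<and>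
     (\<Sum>i\<in>V. \<Sum>j\<in>V. x i j) \<le> real D"

text \<open>The obstruction to bipartiteness: if it is empty, all mass runs from vertices with
  outgoing mass to vertices without.\<close>

definition middle :: "'a set \<Rightarrow> ('a \<Rightarrow> 'a \<Rightarrow> real) \<Rightarrow> 'a set" where
  "middle V x = {j \<in> V. \<exists>i\<in>V. \<exists>k\<in>V. x i j > 0 \<and> x j k > 0}"

lemma sum_sum_of_bool_pair:
  fixes g :: "'a \<Rightarrow> 'b \<Rightarrow> 'c::semiring_1"
  assumes "finite V" "finite W" "i \<in> V" "j \<in> W"
  shows "(\<Sum>u\<in>V. \<Sum>v\<in>W. g u v * of_bool (u = i \<and> v = j)) = g i j"
proof -
  have "(\<Sum>u\<in>V. \<Sum>v\<in>W. g u v * of_bool (u = i \<and> v = j)) =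
      (\<Sum>u\<in>V. if u = i then \<Sum>v\<in>W. if v = j then g u v else 0 else 0)"
    by (intro sum.cong) (auto intro!: sum.cong)
  then show ?thesis using assms by simp
qed

text \<open>\<open>P\<close> models the pairs worth matching and \<open>w\<close> their savings;
  \<open>super\<close> says that skipping an intermediate vertex loses nothing.\<close>

locale superadditive_order =
  fixes V :: "'a set" and P :: "'a \<Rightarrow> 'a \<Rightarrow> bool" and w :: "'a \<Rightarrow> 'a \<Rightarrow> real"
  assumes fin: "finite V"
    and irr: "\<not> P i i"
    and trans: "P i j \<Longrightarrow> P j k \<Longrightarrow> P i k"
    and super: "P i j \<Longrightarrow> P j k \<Longrightarrow> w i j + w j k \<le> w i k"
begin

text \<open>Moving mass \<epsilon> from \<open>(i, j)\<close> and \<open>(j, k)\<close> to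
  \<open>(i, k)\<close> keeps the degrees of \<open>i\<close> and \<open>k\<close>, lowers that of
  \<open>j\<close> by \<open>2 * \<epsilon>\<close> and the size by \<epsilon>. Superadditivity
  makes the move lossless; taking for \<epsilon> the smaller of the two masses empties one of the
  edges.\<close>

lemma shortcut_path:
  assumes x: "fractional_matching V P D x"
    and V: "i \<in> V" "j \<in> V" "k \<in> V" and pos: "x i j > 0" "x j k > 0"
  shows "\<exists>x'. fractional_matching V P D x' \<and> middle V x' \<subseteq> middle V x \<and>
    (\<Sum>u\<in>V. \<Sum>v\<in>V. w u v * x u v) \<le> (\<Sum>u\<in>V. \<Sum>v\<in>V. w u v * x' u v) \<and>
    (\<forall>u\<in>V. x' u j \<le> x u j \<and> x' j u \<le> x j u) \<and> (x' i j = 0 \<or> x' j k = 0)"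
proof -
  have P: "P i j" "P j k" using x V pos by (force simp: fractional_matching_def)+
  have ne: "i \<noteq> j" "j \<noteq> k" "i \<noteq> k" using P irr trans by blast+
  define \<epsilon> where "\<epsilon> = min (x i j) (x j k)"
  have \<epsilon>: "\<epsilon> > 0" "\<epsilon> \<le> x i j" "\<epsilon> \<le> x j k" "\<epsilon> = x i j \<or> \<epsilon> = x j k"
    using pos by (auto simp: \<epsilon>_def)
  define x' where "x' u v = x u v + \<epsilon> * of_bool (u = i \<and> v = k)
    - \<epsilon> * of_bool (u = i \<and> v = j) - \<epsilon> * of_bool (u = j \<and> v = k)" for u v
  have x'_simps: "x' i j = x i j - \<epsilon>" "x' j k = x j k - \<epsilon>" "x' i k = x i k + \<epsilon>"
    using ne by (auto simp: x'_def)
  have x'_other: "x' u v = x u v" if "(u, v) \<noteq> (i, j)" "(u, v) \<noteq> (j, k)" "(u, v) \<noteq> (i, k)" for u v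
    using that by (auto simp: x'_def)
  \<comment> \<open>Stated for any weight \<open>g\<close>: \<open>w\<close> yields the saving, the
    constant 1 the size.\<close>
  have total: "(\<Sum>u\<in>V. \<Sum>v\<in>V. g u v * x' u v) =
      (\<Sum>u\<in>V. \<Sum>v\<in>V. g u v * x u v) + \<epsilon> * (g i k - g i j - g j k)" for g
  proof -
    have "(\<Sum>u\<in>V. \<Sum>v\<in>V. g u v * x' u v) = (\<Sum>u\<in>V. \<Sum>v\<in>V. g u v * x u v)
        + \<epsilon> * (\<Sum>u\<in>V. \<Sum>v\<in>V. g u v * of_bool (u = i \<and> v = k))
        - \<epsilon> * (\<Sum>u\<in>V. \<Sum>v\<in>V. g u v * of_bool (u = i \<and> v = j))
        - \<epsilon> * (\<Sum>u\<in>V. \<Sum>v\<in>V. g u v * of_bool (u = j \<and> v = k))"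
      unfolding x'_def
      by (simp only: sum_distrib_left sum.distrib sum_subtractf ring_distribs mult.left_commute)
    then show ?thesis using sum_sum_of_bool_pair[OF fin fin, of _ _ g] V
      by (simp add: algebra_simps)
  qed
  have delta: "(\<Sum>v\<in>V. of_bool (Q \<and> v = l)) = (of_bool Q :: real)" if "l \<in> V" for Q l
    using that fin by (cases Q) (simp_all add: of_bool_def)
  have deg: "(\<Sum>v\<in>V. x' u v + x' v u) = (\<Sum>v\<in>V. x u v + x v u) - 2 * \<epsilon> * of_bool (u = j)" for u
  proof -
    have "(\<Sum>v\<in>V. x' u v + x' v u) = (\<Sum>v\<in>V. x u v + x v u)
        + \<epsilon> * (\<Sum>v\<in>V. of_bool (u = i \<and> v = k)) - \<epsilon> * (\<Sum>v\<in>V. of_bool (u = i \<and> v = j))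
        - \<epsilon> * (\<Sum>v\<in>V. of_bool (u = j \<and> v = k)) + \<epsilon> * (\<Sum>v\<in>V. of_bool (u = k \<and> v = i))
        - \<epsilon> * (\<Sum>v\<in>V. of_bool (u = j \<and> v = i)) - \<epsilon> * (\<Sum>v\<in>V. of_bool (u = k \<and> v = j))"
      unfolding x'_def
      by (simp add: sum_distrib_left sum.distrib sum_subtractf conj_commute del: sum_of_bool_eq)
    then show ?thesis by (simp add: delta V algebra_simps del: sum_of_bool_eq)
  qed
  have "fractional_matching V P D x'"
    unfolding fractional_matching_def
  proof (intro conjI ballI impI)
    fix u v assume uv: "u \<in> V" "v \<in> V"
    then have xuv: "0 \<le> x u v" "x u v \<noteq> 0 \<Longrightarrow> P u v" using x by (auto simp: fractional_matching_def)
    show "0 \<le> x' u v" using x'_simps x'_other[of u v] \<epsilon> xuv(1) by force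
    show "P u v" if "x' u v \<noteq> 0"
      using x'_other[of u v] that xuv(2) P trans[OF P] by force
  next
    fix u assume "u \<in> V"
    then show "(\<Sum>v\<in>V. x' u v + x' v u) \<le> 1"
      unfolding deg using x \<epsilon>(1) by (auto simp: fractional_matching_def of_bool_def)
  next
    show "(\<Sum>u\<in>V. \<Sum>v\<in>V. x' u v) \<le> real D"
      using total[of "\<lambda>_ _. 1"] x \<epsilon>(1) by (simp add: fractional_matching_def)
  qed
  moreover have "middle V x' \<subseteq> middle V x"
  proof
    fix m assume "m \<in> middle V x'"
    then obtain u v where m: "m \<in> V" "u \<in> V" "v \<in> V" "x' u m > 0" "x' m v > 0"
      by (auto simp: middle_def)
    \<comment> \<open>Only \<open>(i, k)\<close> gains mass, and in \<open>x\<close> its ends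
      already play these roles: \<open>k\<close> is the upper end of \<open>(j, k)\<close> and
      \<open>i\<close> the lower end of \<open>(i, j)\<close>.\<close>
    have "\<exists>u\<in>V. x u m > 0"
    proof (cases "m = k")
      case False
      then have "x' u m \<le> x u m" using \<epsilon>(1) by (simp add: x'_def)
      then show ?thesis using m by force
    qed (use V pos in blast)
    moreover have "\<exists>v\<in>V. x m v > 0"
    proof (cases "m = i")
      case False
      then have "x' m v \<le> x m v" using \<epsilon>(1) by (simp add: x'_def)
      then show ?thesis using m by force
    qed (use V pos in blast)
    ultimately show "m \<in> middle V x" using m(1) by (auto simp: middle_def)
  qed
  moreover have "(\<Sum>u\<in>V. \<Sum>v\<in>V. w u v * x u v) \<le> (\<Sum>u\<in>V. \<Sum>v\<in>V. w u v * x' u v)"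
    unfolding total using super[OF P] \<epsilon>(1) by simp
  moreover have "\<forall>u\<in>V. x' u j \<le> x u j \<and> x' j u \<le> x j u"
    using ne \<epsilon>(1) by (auto simp: x'_def)
  moreover have "x' i j = 0 \<or> x' j k = 0" using \<epsilon>(4) by (auto simp: x'_simps)
  ultimately show ?thesis by blast
qed

text \<open>Shortcuts through \<open>j\<close> are repeated while \<open>j\<close> is a middle
  vertex. Each one deletes an edge at \<open>j\<close> and creates none there, so the number of
  edges at \<open>j\<close> is a decreasing measure.\<close>

lemma remove_middle_vertex:
  assumes "fractional_matching V P D x" "j \<in> V"
  shows "\<exists>x'. fractional_matching V P D x' \<and> middle V x' \<subseteq> middle V x - {j} \<and>
    (\<Sum>u\<in>V. \<Sum>v\<in>V. w u v * x u v) \<le> (\<Sum>u\<in>V. \<Sum>v\<in>V. w u v * x' u v)"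
  using assms(1)
proof (induction "card {u\<in>V. x u j > 0} + card {v\<in>V. x j v > 0}" arbitrary: x rule: less_induct)
  case less
  show ?case
  proof (cases "j \<in> middle V x")
    case False
    then show ?thesis using less.prems by (intro exI[of _ x]) auto
  next
    case True
    then obtain i k where ik: "i \<in> V" "k \<in> V" "x i j > 0" "x j k > 0" by (auto simp: middle_def)
    from shortcut_path[OF less.prems ik(1) assms(2) ik(2-4)] obtain y where y:
      "fractional_matching V P D y" "middle V y \<subseteq> middle V x"
      "(\<Sum>u\<in>V. \<Sum>v\<in>V. w u v * x u v) \<le> (\<Sum>u\<in>V. \<Sum>v\<in>V. w u v * y u v)"
      "\<forall>u\<in>V. y u j \<le> x u j \<and> y j u \<le> x j u" "y i j = 0 \<or> y j k = 0" by blast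
    have sub: "{u\<in>V. y u j > 0} \<subseteq> {u\<in>V. x u j > 0}" "{v\<in>V. y j v > 0} \<subseteq> {v\<in>V. x j v > 0}"
      using y(4) by force+
    have le: "card {u\<in>V. y u j > 0} \<le> card {u\<in>V. x u j > 0}"
      "card {v\<in>V. y j v > 0} \<le> card {v\<in>V. x j v > 0}"
      using sub fin by (auto intro!: card_mono)
    have "card {u\<in>V. y u j > 0} + card {v\<in>V. y j v > 0}
        < card {u\<in>V. x u j > 0} + card {v\<in>V. x j v > 0}"
    proof (cases "y i j = 0")
      case True
      then have "{u\<in>V. y u j > 0} \<subset> {u\<in>V. x u j > 0}" using sub(1) ik by force
      then have "card {u\<in>V. y u j > 0} < card {u\<in>V. x u j > 0}"
        using fin by (intro psubset_card_mono) auto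
      then show ?thesis using le(2) by linarith
    next
      case False
      then have "{v\<in>V. y j v > 0} \<subset> {v\<in>V. x j v > 0}" using y(5) sub(2) ik by force
      then have "card {v\<in>V. y j v > 0} < card {v\<in>V. x j v > 0}"
        using fin by (intro psubset_card_mono) auto
      then show ?thesis using le(1) by linarith
    qed
    from less.hyps[OF this y(1)] y(2,3) show ?thesis by (meson order_trans Diff_mono subset_refl)
  qed
qed

text \<open>Middle vertices are removed one at a time; as removal creates no new ones, their number
  decreases.\<close>

lemma exists_middle_free:
  assumes "fractional_matching V P D x"
  shows "\<exists>x'. fractional_matching V P D x' \<and> middle V x' = {} \<and>
    (\<Sum>u\<in>V. \<Sum>v\<in>V. w u v * x u v) \<le> (\<Sum>u\<in>V. \<Sum>v\<in>V. w u v * x' u v)"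
  using assms
proof (induction "card (middle V x)" arbitrary: x rule: less_induct)
  case less
  show ?case
  proof (cases "middle V x = {}")
    case True
    then show ?thesis using less.prems by blast
  next
    case False
    then obtain j where j: "j \<in> middle V x" by blast
    then have "j \<in> V" by (simp add: middle_def)
    from remove_middle_vertex[OF less.prems this] obtain y where y:
      "fractional_matching V P D y" "middle V y \<subseteq> middle V x - {j}"
      "(\<Sum>u\<in>V. \<Sum>v\<in>V. w u v * x u v) \<le> (\<Sum>u\<in>V. \<Sum>v\<in>V. w u v * y u v)" by blast
    have "finite (middle V x)" using fin by (simp add: middle_def)
    then have "card (middle V y) < card (middle V x)"
      using y(2) j by (intro psubset_card_mono) auto
    from less.hyps[OF this y(1)] y(3) show ?thesis by (meson order_trans)
  qed
qed

end

section \<open>Rounding a bipartite fractional matching\<close>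

text \<open>Without middle vertices all mass lies in a block \<open>L \<times> U\<close>, in which
  the degrees are row and column sums. This block, bordered by slacks, is a matrix with integral
  margins and can be rounded.\<close>

lemma round_bipartite_matching:
  fixes x w :: "'a \<Rightarrow> 'a \<Rightarrow> real"
  assumes fin: "finite V" and x: "fractional_matching V P D x" and mid: "middle V x = {}"
  shows "\<exists>z. fractional_matching V P D z \<and> (\<forall>i\<in>V. \<forall>j\<in>V. z i j \<in> \<int>) \<and>
    (\<Sum>i\<in>V. \<Sum>j\<in>V. w i j * x i j) \<le> (\<Sum>i\<in>V. \<Sum>j\<in>V. w i j * z i j)"
proof -
  define L where "L = {i\<in>V. \<exists>k\<in>V. x i k > 0}"
  define U where "U = V - L"
  have LU: "finite L" "finite U" "L \<subseteq> V" "U \<subseteq> V" "L \<inter> U = {}" "V = L \<union> U"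
    using fin by (auto simp: L_def U_def)
  have xpos: "0 \<le> x i j" "x i j \<noteq> 0 \<Longrightarrow> P i j" if "i \<in> V" "j \<in> V" for i j
    using x that by (auto simp: fractional_matching_def)
  \<comment> \<open>A positive entry puts \<open>i\<close> into \<open>L\<close>; if
    \<open>j\<close> were in \<open>L\<close> too, it would be a middle vertex.\<close>
  have supp: "x i j = 0" if "i \<in> V" "j \<in> V" "i \<notin> L \<or> j \<notin> U" for i j
  proof (rule ccontr)
    assume "x i j \<noteq> 0"
    then have "x i j > 0" using xpos(1)[OF that(1,2)] by simp
    then show False using that mid by (auto simp: L_def U_def middle_def)
  qed
  have restrict: "(\<Sum>i\<in>V. \<Sum>j\<in>V. g i j) = (\<Sum>i\<in>L. \<Sum>j\<in>U. g i j)"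
    if "\<And>i j. i \<in> V \<Longrightarrow> j \<in> V \<Longrightarrow> i \<notin> L \<or> j \<notin> U \<Longrightarrow> g i j = 0" for g :: "'a \<Rightarrow> 'a \<Rightarrow> real"
  proof -
    have "(\<Sum>i\<in>V. \<Sum>j\<in>V. g i j) = (\<Sum>i\<in>L. \<Sum>j\<in>V. g i j)"
      by (rule sum.mono_neutral_right) (use LU fin that in auto)
    also have "\<dots> = (\<Sum>i\<in>L. \<Sum>j\<in>U. g i j)"
      by (intro sum.cong refl sum.mono_neutral_right) (use LU fin that in auto)
    finally show ?thesis .
  qed
  define T where "T = (\<Sum>i\<in>L. \<Sum>j\<in>U. x i j)"
  have T: "0 \<le> T" "T \<le> real D"
    using x restrict[of x] supp LU by (auto simp: T_def fractional_matching_def intro!: sum_nonneg xpos)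
  have rowle: "(\<Sum>j\<in>U. x i j) \<le> 1" if "i \<in> L" for i
  proof -
    have "(\<Sum>j\<in>U. x i j) \<le> (\<Sum>j\<in>U. x i j + x j i)"
      by (rule sum_mono) (use that LU xpos in auto)
    also have "\<dots> \<le> (\<Sum>j\<in>V. x i j + x j i)"
      by (rule sum_mono2) (use that LU xpos fin in auto)
    also have "\<dots> \<le> 1" using x that LU by (auto simp: fractional_matching_def)
    finally show ?thesis .
  qed
  have colle: "(\<Sum>i\<in>L. x i j) \<le> 1" if "j \<in> U" for j
  proof -
    have "(\<Sum>i\<in>L. x i j) \<le> (\<Sum>i\<in>L. x j i + x i j)"
      by (rule sum_mono) (use that LU xpos in auto)
    also have "\<dots> \<le> (\<Sum>i\<in>V. x j i + x i j)"
      by (rule sum_mono2) (use that LU xpos fin in auto)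
    also have "\<dots> \<le> 1" using x that LU by (auto simp: fractional_matching_def)
    finally show ?thesis .
  qed
  \<comment> \<open>Index \<open>None\<close> collects the slacks. With the total \<open>T\<close> in the corner all margins are integers,
    and the corner entry of any matrix with the same margins is its total over \<open>L \<times> U\<close>, so that
    rounding the corner up preserves the cardinality bound.\<close>
  define X where "X r c = (case (r, c) of (Some i, Some j) \<Rightarrow> x i j
      | (Some i, None) \<Rightarrow> 1 - (\<Sum>j\<in>U. x i j) | (None, Some j) \<Rightarrow> 1 - (\<Sum>i\<in>L. x i j)
      | (None, None) \<Rightarrow> T)" for r c
  \<comment> \<open>Matrix rounding does not increase the cost, so savings enter negated; slacks are
    free.\<close>
  define W where "W r c = (case (r, c) of (Some i, Some j) \<Rightarrow> - w i j | _ \<Rightarrow> 0)" for r c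
  define R where "R = insert None (Some ` L)"
  define C where "C = insert None (Some ` U)"
  have RC: "finite R" "finite C" using LU by (simp_all add: R_def C_def)
  have sumR: "(\<Sum>r\<in>R. g r) = g None + (\<Sum>i\<in>L. g (Some i))" for g :: "'a option \<Rightarrow> real"
    unfolding R_def using LU by (simp add: sum.reindex)
  have sumC: "(\<Sum>r\<in>C. g r) = g None + (\<Sum>i\<in>U. g (Some i))" for g :: "'a option \<Rightarrow> real"
    unfolding C_def using LU by (simp add: sum.reindex)
  have rowX: "(\<Sum>c\<in>C. X r c) = (case r of None \<Rightarrow> real (card U) | Some i \<Rightarrow> 1)" for r
    using sum.swap[of x U L]
    by (auto simp: sumC X_def T_def sum_subtractf split: option.splits)
  have colX: "(\<Sum>r\<in>R. X r c) = (case c of None \<Rightarrow> real (card L) | Some i \<Rightarrow> 1)" for c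
    by (auto simp: sumR X_def T_def sum_subtractf split: option.splits)
  have "(\<Sum>c\<in>C. X r c) \<in> \<int>" "(\<Sum>r\<in>R. X r c) \<in> \<int>" for r c
    unfolding rowX colX by (auto split: option.splits)
  from integral_matrix_rounding[OF RC this, of W] obtain Z where Z:
    "\<forall>r\<in>R. \<forall>c\<in>C. Z r c \<in> \<int> \<and> of_int \<lfloor>X r c\<rfloor> \<le> Z r c \<and> Z r c \<le> of_int \<lceil>X r c\<rceil>"
    "\<forall>r\<in>R. (\<Sum>c\<in>C. Z r c) = (\<Sum>c\<in>C. X r c)"
    "\<forall>c\<in>C. (\<Sum>r\<in>R. Z r c) = (\<Sum>r\<in>R. X r c)"
    "(\<Sum>r\<in>R. \<Sum>c\<in>C. W r c * Z r c) \<le> (\<Sum>r\<in>R. \<Sum>c\<in>C. W r c * X r c)"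
    by blast
  have Z0: "0 \<le> Z r c" if "r \<in> R" "c \<in> C" for r c
  proof -
    have "0 \<le> X r c" using that T rowle colle xpos LU
      by (auto simp: X_def R_def C_def split: option.splits)
    then have "0 \<le> real_of_int \<lfloor>X r c\<rfloor>" by simp
    then show ?thesis using Z(1) that by (meson order_trans)
  qed
  define z where "z i j = (if i \<in> L \<and> j \<in> U then Z (Some i) (Some j) else 0)" for i j
  have z0: "0 \<le> z i j" for i j using Z0 by (auto simp: z_def R_def C_def)
  have zint: "z i j \<in> \<int>" for i j using Z(1) by (auto simp: z_def R_def C_def)
  \<comment> \<open>Entries outside \<open>P\<close> are zero in \<open>x\<close>, and the floor and
    ceiling bounds keep them zero.\<close>
  have zsupp: "P i j" if "i \<in> V" "j \<in> V" "z i j \<noteq> 0" for i j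
  proof (rule ccontr)
    assume "\<not> P i j"
    then have "x i j = 0" using xpos that by blast
    moreover have ij: "i \<in> L" "j \<in> U" using that by (auto simp: z_def split: if_splits)
    moreover have "Some i \<in> R" "Some j \<in> C" using ij by (auto simp: R_def C_def)
    ultimately have "z i j = 0" using Z(1)[rule_format, of "Some i" "Some j"]
      by (simp add: z_def X_def)
    then show False using that by simp
  qed
  have rowZ: "Z (Some i) None + (\<Sum>j\<in>U. Z (Some i) (Some j)) = 1" if "i \<in> L" for i
    using Z(2)[rule_format, of "Some i"] that rowX[of "Some i"] by (simp add: sumC R_def)
  have colZ: "Z None (Some j) + (\<Sum>i\<in>L. Z (Some i) (Some j)) = 1" if "j \<in> U" for j
    using Z(3)[rule_format, of "Some j"] that colX[of "Some j"] by (simp add: sumR C_def)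
  \<comment> \<open>Column \<open>None\<close> and the rows of \<open>L\<close> together have the
    same total \<open>card L\<close>; the slacks cancel in the comparison.\<close>
  have "Z None None + (\<Sum>i\<in>L. Z (Some i) None) = real (card L)"
    using Z(3)[rule_format, of None] colX[of None] by (simp add: sumR C_def)
  moreover have "(\<Sum>i\<in>L. Z (Some i) None + (\<Sum>j\<in>U. Z (Some i) (Some j))) = real (card L)"
    using rowZ by simp
  ultimately have tot: "(\<Sum>i\<in>L. \<Sum>j\<in>U. Z (Some i) (Some j)) = Z None None"
    by (simp add: sum.distrib)
  have "fractional_matching V P D z"
    unfolding fractional_matching_def
  proof (intro conjI ballI impI)
    show "0 \<le> z i j" for i j by (rule z0)
    show "P i j" if "i \<in> V" "j \<in> V" "z i j \<noteq> 0" for i j using zsupp that .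
    show "(\<Sum>j\<in>V. z i j + z j i) \<le> 1" if "i \<in> V" for i
    proof (cases "i \<in> L")
      case True
      have "(\<Sum>j\<in>V. z i j + z j i) = (\<Sum>j\<in>U. Z (Some i) (Some j))"
        by (rule sum.mono_neutral_cong_right) (use True LU fin in \<open>auto simp: z_def\<close>)
      then show ?thesis using rowZ[OF True] Z0[of "Some i" None] True by (simp add: R_def C_def)
    next
      case False
      then have iU: "i \<in> U" using that LU by blast
      have "(\<Sum>j\<in>V. z i j + z j i) = (\<Sum>j\<in>L. Z (Some j) (Some i))"
        by (rule sum.mono_neutral_cong_right) (use iU LU fin in \<open>auto simp: z_def\<close>)
      then show ?thesis using colZ[OF iU] Z0[of None "Some i"] iU by (simp add: R_def C_def)
    qed
    have "(\<Sum>i\<in>V. \<Sum>j\<in>V. z i j) = Z None None"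
      by (subst restrict) (auto simp: z_def tot)
    \<comment> \<open>Since the bound \<open>D\<close> is an integer, it also bounds the rounded-up
      corner.\<close>
    also have "\<dots> \<le> of_int \<lceil>T\<rceil>"
      using Z(1)[rule_format, of None None] by (simp add: R_def C_def X_def)
    also have "\<dots> \<le> real_of_int (int D)" using T(2) by (subst of_int_le_iff) (simp add: ceiling_le_iff)
    finally show "(\<Sum>i\<in>V. \<Sum>j\<in>V. z i j) \<le> real D" by simp
  qed
  moreover have "(\<Sum>i\<in>V. \<Sum>j\<in>V. w i j * x i j) \<le> (\<Sum>i\<in>V. \<Sum>j\<in>V. w i j * z i j)"
  proof -
    have "(\<Sum>i\<in>L. \<Sum>j\<in>U. w i j * x i j) \<le> (\<Sum>i\<in>L. \<Sum>j\<in>U. w i j * Z (Some i) (Some j))"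
      using Z(4) by (simp add: sumR sumC W_def X_def sum_negf)
    moreover have "(\<Sum>i\<in>V. \<Sum>j\<in>V. w i j * x i j) = (\<Sum>i\<in>L. \<Sum>j\<in>U. w i j * x i j)"
      by (rule restrict) (simp add: supp)
    moreover have "(\<Sum>i\<in>V. \<Sum>j\<in>V. w i j * z i j) = (\<Sum>i\<in>L. \<Sum>j\<in>U. w i j * Z (Some i) (Some j))"
      by (subst restrict) (auto simp: z_def)
    ultimately show ?thesis by simp
  qed
  ultimately show ?thesis using zint by blast
qed

section \<open>Translation between the linear program and fractional matchings\<close>

text \<open>The saving is symmetric in \<open>i\<close> and \<open>j\<close>; the orientation picks
  each unordered pair with positive saving exactly once.\<close>

definition comparable_below :: "('a \<Rightarrow> real) \<Rightarrow> ('a \<Rightarrow> real) \<Rightarrow> 'a \<Rightarrow> 'a \<Rightarrow> bool" where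
  "comparable_below a b i j \<longleftrightarrow> a i < a j \<and> b i < b j"

text \<open>Splitting both differences at \<open>j\<close> and expanding the product leaves two
  cross terms, which are nonnegative along a chain.\<close>

lemma superadditive_order_comparable_below:
  assumes "finite V"
  shows "superadditive_order V (comparable_below a b) (\<lambda>i j. (a j - a i) * (b j - b i))"
proof
  show "finite V" by fact
next
  fix i j k assume "comparable_below a b i j" "comparable_below a b j k"
  then have "0 \<le> (a j - a i) * (b k - b j)" "0 \<le> (a k - a j) * (b j - b i)"
    by (simp_all add: comparable_below_def)
  then show "(a j - a i) * (b j - b i) + (a k - a j) * (b k - b j) \<le> (a k - a i) * (b k - b i)"
    by (simp add: algebra_simps)
qed (auto simp: comparable_below_def)

text \<open>Expanding the product, the terms \<open>a i * b i\<close> and \<open>a j * b j\<close>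
  collapse by unit row sums and symmetry, and each of the two mixed terms gives the cost. The factor
  2 reflects that every pair occurs in both orders.\<close>

lemma symmetric_cost_eq:
  fixes a b :: "'a \<Rightarrow> real"
  assumes "finite V" "\<And>i. i \<in> V \<Longrightarrow> (\<Sum>j\<in>V. y i j) = 1"
    "\<And>i j. i \<in> V \<Longrightarrow> j \<in> V \<Longrightarrow> y i j = y j i"
  shows "2 * (\<Sum>i\<in>V. \<Sum>j\<in>V. a i * b j * y i j) =
    2 * (\<Sum>i\<in>V. a i * b i) - (\<Sum>i\<in>V. \<Sum>j\<in>V. (a j - a i) * (b j - b i) * y i j)"
proof -
  have s: "(\<Sum>i\<in>V. \<Sum>j\<in>V. a i * b i * y i j) = (\<Sum>i\<in>V. a i * b i)"
    using assms(2) by (simp flip: sum_distrib_left)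
  have swap: "(\<Sum>i\<in>V. \<Sum>j\<in>V. g j i * y i j) = (\<Sum>i\<in>V. \<Sum>j\<in>V. g i j * y i j)" for g
    by (subst sum.swap) (use assms(3) in \<open>auto intro!: sum.cong\<close>)
  have "(\<Sum>i\<in>V. \<Sum>j\<in>V. (a j - a i) * (b j - b i) * y i j) =
    (\<Sum>i\<in>V. \<Sum>j\<in>V. a j * b j * y i j) + (\<Sum>i\<in>V. \<Sum>j\<in>V. a i * b i * y i j)
    - (\<Sum>i\<in>V. \<Sum>j\<in>V. a i * b j * y i j) - (\<Sum>i\<in>V. \<Sum>j\<in>V. a j * b i * y i j)"
    by (simp add: algebra_simps sum.distrib sum_subtractf)
  then show ?thesis using swap[of "\<lambda>i j. a i * b i"] swap[of "\<lambda>i j. a i * b j"] s by simp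
qed

text \<open>Only entries at comparable pairs are kept, in one orientation. The discarded pairs have
  nonpositive savings, so the matching saves at least as much as \<open>y\<close>.\<close>

lemma fractional_matching_of_lp_feasible:
  fixes a b :: "nat \<Rightarrow> real"
  assumes y: "lp_feasible n \<Delta> y"
  defines "P \<equiv> comparable_below a b"
  defines "x \<equiv> \<lambda>i j. if P i j then y i j else 0"
  shows "fractional_matching {1..n} P \<Delta> x"
    and "(\<Sum>i\<in>{1..n}. a i * b i) - (\<Sum>i\<in>{1..n}. \<Sum>j\<in>{1..n}. (a j - a i) * (b j - b i) * x i j)
      \<le> lp_cost n a b y"
proof -
  let ?V = "{1..n}"
  have row: "(\<Sum>j\<in>?V. y i j) = 1" if "i \<in> ?V" for i using y that by (simp add: lp_feasible_def)
  have sym: "y i j = y j i" if "i \<in> ?V" "j \<in> ?V" for i j using y that by (simp add: lp_feasible_def)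
  have nn: "0 \<le> y i j" if "i \<in> ?V" "j \<in> ?V" for i j using y that by (simp add: lp_feasible_def)
  have P: "\<not> P i i" "P i j \<Longrightarrow> \<not> P j i" for i j by (auto simp: P_def comparable_below_def)
  \<comment> \<open>Off the diagonal at most one orientation survives; on the diagonal both sides
    are zero.\<close>
  have le: "x i j + x j i \<le> y i j - of_bool (i = j) * y i j" if "i \<in> ?V" "j \<in> ?V" for i j
    using P nn[OF that] sym[OF that] by (auto simp: x_def)
  show "fractional_matching ?V P \<Delta> x"
    unfolding fractional_matching_def
  proof (intro conjI ballI impI)
    show "0 \<le> x i j" if "i \<in> ?V" "j \<in> ?V" for i j using nn that by (simp add: x_def)
    show "P i j" if "x i j \<noteq> 0" for i j using that by (simp add: x_def split: if_splits)
    show "(\<Sum>j\<in>?V. x i j + x j i) \<le> 1" if "i \<in> ?V" for i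
    proof -
      have "x i j + x j i \<le> y i j" if "j \<in> ?V" for j
        using le[OF \<open>i \<in> ?V\<close> that] nn[OF \<open>i \<in> ?V\<close> that] by (cases "i = j") auto
      then have "(\<Sum>j\<in>?V. x i j + x j i) \<le> (\<Sum>j\<in>?V. y i j)" by (intro sum_mono)
      then show ?thesis using row[OF that] by simp
    qed
    \<comment> \<open>The off-diagonal mass of \<open>y\<close> is \<open>n\<close> minus the trace,
      hence at most \<open>2 * \<Delta>\<close>, and it covers each edge twice.\<close>
    have "2 * (\<Sum>i\<in>?V. \<Sum>j\<in>?V. x i j) = (\<Sum>i\<in>?V. \<Sum>j\<in>?V. x i j + x j i)"
      using sum.swap[of x ?V ?V] by (simp add: sum.distrib)
    also have "\<dots> \<le> (\<Sum>i\<in>?V. \<Sum>j\<in>?V. y i j - of_bool (i = j) * y i j)"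
      using le by (intro sum_mono)
    also have "\<dots> = (\<Sum>i\<in>?V. 1 - y i i)"
    proof (rule sum.cong[OF refl])
      fix i assume i: "i \<in> ?V"
      have "(\<Sum>j\<in>?V. of_bool (i = j) * y i j) = (\<Sum>j\<in>?V. if i = j then y i j else 0)"
        by (rule sum.cong) auto
      also have "\<dots> = y i i" using i by simp
      finally show "(\<Sum>j\<in>?V. y i j - of_bool (i = j) * y i j) = 1 - y i i"
        using row[OF i] by (simp add: sum_subtractf)
    qed
    also have "\<dots> \<le> 2 * real \<Delta>" using y by (simp add: sum_subtractf lp_feasible_def)
    finally show "(\<Sum>i\<in>?V. \<Sum>j\<in>?V. x i j) \<le> real \<Delta>" by simp
  qed
  let ?w = "\<lambda>i j. (a j - a i) * (b j - b i)"
  have "(\<Sum>i\<in>?V. \<Sum>j\<in>?V. ?w i j * y i j) \<le> (\<Sum>i\<in>?V. \<Sum>j\<in>?V. ?w i j * x i j + ?w j i * x j i)"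
  proof (intro sum_mono)
    fix i j assume ij: "i \<in> ?V" "j \<in> ?V"
    show "?w i j * y i j \<le> ?w i j * x i j + ?w j i * x j i"
    proof (cases "P i j \<or> P j i")
      case True
      have "?w j i = ?w i j" by (simp add: algebra_simps)
      then show ?thesis using True P sym[OF ij] by (auto simp: x_def)
    next
      case False
      then have "?w i j \<le> 0"
        by (auto simp: P_def comparable_below_def not_less mult_le_0_iff)
      then show ?thesis using False nn[OF ij] by (simp add: x_def mult_nonpos_nonneg)
    qed
  qed
  also have "\<dots> = 2 * (\<Sum>i\<in>?V. \<Sum>j\<in>?V. ?w i j * x i j)"
    using sum.swap[of "\<lambda>i j. ?w j i * x j i" ?V ?V] by (simp add: sum.distrib)
  finally show "(\<Sum>i\<in>?V. a i * b i) - (\<Sum>i\<in>?V. \<Sum>j\<in>?V. ?w i j * x i j) \<le> lp_cost n a b y"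
    using symmetric_cost_eq[of ?V y a b] row sym by (simp add: lp_cost_def)
qed

text \<open>The matching is symmetrised and the unmatched part of each vertex goes to the diagonal.
  Rows then sum to 1, and the trace is \<open>n\<close> minus twice the size.\<close>

lemma lp_feasible_of_fractional_matching:
  fixes a b :: "nat \<Rightarrow> real"
  assumes x: "fractional_matching {1..n} P \<Delta> x" and irr: "\<And>i. \<not> P i i"
  defines "y \<equiv> \<lambda>i j. x i j + x j i + (if i = j then 1 - (\<Sum>k\<in>{1..n}. x i k + x k i) else 0)"
  shows "lp_feasible n \<Delta> y"
    and "lp_cost n a b y =
      (\<Sum>i\<in>{1..n}. a i * b i) - (\<Sum>i\<in>{1..n}. \<Sum>j\<in>{1..n}. (a j - a i) * (b j - b i) * x i j)"
proof -
  let ?V = "{1..n}"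
  have x0: "0 \<le> x i j" if "i \<in> ?V" "j \<in> ?V" for i j
    using x that by (simp add: fractional_matching_def)
  have diag: "x i i = 0" if "i \<in> ?V" for i
    using x that irr unfolding fractional_matching_def by blast
  have deg: "(\<Sum>k\<in>?V. x i k + x k i) \<le> 1" if "i \<in> ?V" for i
    using x that by (simp add: fractional_matching_def)
  have sym: "y i j = y j i" for i j by (simp add: y_def)
  have row: "(\<Sum>j\<in>?V. y i j) = 1" if "i \<in> ?V" for i
    using that by (simp add: y_def sum.distrib)
  have twice: "(\<Sum>i\<in>?V. \<Sum>j\<in>?V. x i j + x j i) = 2 * (\<Sum>i\<in>?V. \<Sum>j\<in>?V. x i j)"
    using sum.swap[of x ?V ?V] by (simp add: sum.distrib)
  have "(\<Sum>i\<in>?V. y i i) = (\<Sum>i\<in>?V. 1 - (\<Sum>k\<in>?V. x i k + x k i))"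
    by (rule sum.cong) (simp_all add: y_def diag)
  also have "\<dots> = real n - 2 * (\<Sum>i\<in>?V. \<Sum>j\<in>?V. x i j)"
    unfolding sum_subtractf twice by simp
  finally have "(\<Sum>i\<in>?V. y i i) \<ge> real n - 2 * real \<Delta>"
    using x by (simp add: fractional_matching_def)
  moreover have "0 \<le> y i j" if "i \<in> ?V" "j \<in> ?V" for i j
    using x0 deg that by (simp add: y_def)
  moreover have "(\<Sum>i\<in>?V. y i j) = 1" if "j \<in> ?V" for j
    using row[OF that] sym[of j] by simp
  ultimately show "lp_feasible n \<Delta> y"
    using row sym by (simp add: lp_feasible_def)
  let ?w = "\<lambda>i j. (a j - a i) * (b j - b i)"
  \<comment> \<open>The diagonal correction drops out because \<open>?w i i\<close> is zero.\<close>
  have "(\<Sum>i\<in>?V. \<Sum>j\<in>?V. ?w i j * y i j) = (\<Sum>i\<in>?V. \<Sum>j\<in>?V. ?w i j * x i j + ?w j i * x j i)"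
    by (intro sum.cong refl) (auto simp: y_def algebra_simps)
  also have "\<dots> = 2 * (\<Sum>i\<in>?V. \<Sum>j\<in>?V. ?w i j * x i j)"
    using sum.swap[of "\<lambda>i j. ?w j i * x j i" ?V ?V] by (simp add: sum.distrib)
  finally show "lp_cost n a b y = (\<Sum>i\<in>?V. a i * b i) - (\<Sum>i\<in>?V. \<Sum>j\<in>?V. ?w i j * x i j)"
    using symmetric_cost_eq[of ?V y a b] row sym by (simp add: lp_cost_def)
qed

section \<open>Binary solutions and existence of an optimum\<close>

lemma Ints_unit_interval:
  fixes t :: real
  assumes "t \<in> \<int>" "0 \<le> t" "t \<le> 1"
  shows "t \<in> {0, 1}"
proof -
  from assms(1) obtain k where "t = of_int k" by (rule Ints_cases)
  with assms show ?thesis by auto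
qed

text \<open>The saving does not decrease in passing from \<open>y\<close> to a matching, removing
  middle vertices and rounding. The matrix rebuilt from the integral matching is integral and
  nonnegative with unit row sums, hence binary.\<close>

lemma binary_solution_at_most_cost:
  assumes "lp_feasible n \<Delta> y"
  shows "\<exists>z. lp_feasible n \<Delta> z \<and> (\<forall>i\<in>{1..n}. \<forall>j\<in>{1..n}. z i j \<in> {0, 1}) \<and>
    lp_cost n a b z \<le> lp_cost n a b y"
proof -
  let ?V = "{1..n}" and ?P = "comparable_below a b"
  let ?w = "\<lambda>i j. (a j - a i) * (b j - b i)"
  interpret superadditive_order ?V ?P ?w
    by (rule superadditive_order_comparable_below) simp
  note y = fractional_matching_of_lp_feasible[OF assms, of a b]
  from exists_middle_free[OF y(1)] obtain x where x: "fractional_matching ?V ?P \<Delta> x"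
    "middle ?V x = {}" and xc: "(\<Sum>i\<in>?V. \<Sum>j\<in>?V. ?w i j * (if ?P i j then y i j else 0))
      \<le> (\<Sum>i\<in>?V. \<Sum>j\<in>?V. ?w i j * x i j)" by blast
  from round_bipartite_matching[OF fin x, of ?w] obtain m where
    m: "fractional_matching ?V ?P \<Delta> m" "\<forall>i\<in>?V. \<forall>j\<in>?V. m i j \<in> \<int>"
    "(\<Sum>i\<in>?V. \<Sum>j\<in>?V. ?w i j * x i j) \<le> (\<Sum>i\<in>?V. \<Sum>j\<in>?V. ?w i j * m i j)" by blast
  define z where "z = (\<lambda>i j. m i j + m j i +
    (if i = j then 1 - (\<Sum>k\<in>?V. m i k + m k i) else 0))"
  note z = lp_feasible_of_fractional_matching[OF m(1) irr, folded z_def]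
  have "z i j \<in> {0, 1}" if "i \<in> ?V" "j \<in> ?V" for i j
  proof (rule Ints_unit_interval)
    show "z i j \<in> \<int>" unfolding z_def using m(2) that by (auto intro!: Ints_sum Ints_add Ints_diff)
    show "0 \<le> z i j" using z(1) that by (simp add: lp_feasible_def)
    have "z i j \<le> (\<Sum>k\<in>?V. z i k)"
      by (rule member_le_sum) (use z(1) that in \<open>auto simp: lp_feasible_def\<close>)
    then show "z i j \<le> 1" using z(1) that by (simp add: lp_feasible_def)
  qed
  moreover have "lp_cost n a b z \<le> lp_cost n a b y"
    unfolding z(2) using m(3) xc y(2) by linarith
  ultimately show ?thesis using z(1) by blast
qed

lemma lp_feasible_cong:
  assumes "\<And>i j. i \<in> {1..n} \<Longrightarrow> j \<in> {1..n} \<Longrightarrow> y i j = z i j"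
  shows "lp_feasible n \<Delta> y \<longleftrightarrow> lp_feasible n \<Delta> z"
  using assms by (simp add: lp_feasible_def)

lemma lp_cost_cong:
  assumes "\<And>i j. i \<in> {1..n} \<Longrightarrow> j \<in> {1..n} \<Longrightarrow> y i j = z i j"
  shows "lp_cost n a b y = lp_cost n a b z"
  using assms by (simp add: lp_cost_def)

theorem theorem6:
  fixes n \<Delta> :: nat
    and a b :: "nat \<Rightarrow> real"
  assumes "\<forall>i\<in>{1..n}. a i \<ge> 0"
    and "\<forall>i\<in>{1..n}. b i \<ge> 0"
  shows "\<exists>y :: nat \<Rightarrow> nat \<Rightarrow> real.
           lp_optimal n \<Delta> a b y \<and> (\<forall>i\<in>{1..n}. \<forall>j\<in>{1..n}. y i j \<in> {0, 1})"
proof -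
  \<comment> \<open>Binary matrices are encoded by sets of index pairs, which fixes their values
    outside the index range and leaves finitely many candidates. A cheapest one exists, and by
    \<open>below\<close> it is optimal among all feasible matrices.\<close>
  define ind :: "(nat \<times> nat) set \<Rightarrow> nat \<Rightarrow> nat \<Rightarrow> real" where "ind E i j = of_bool ((i, j) \<in> E)" for E i j
  define S where "S = {E. E \<subseteq> {1..n} \<times> {1..n} \<and> lp_feasible n \<Delta> (ind E)}"
  have fin: "finite S" unfolding S_def by (rule finite_subset[of _ "Pow ({1..n} \<times> {1..n})"]) auto
  have below: "\<exists>E\<in>S. lp_cost n a b (ind E) \<le> lp_cost n a b y" if "lp_feasible n \<Delta> y" for y
  proof -
    from binary_solution_at_most_cost[OF that] obtain z where z: "lp_feasible n \<Delta> z"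
      "\<forall>i\<in>{1..n}. \<forall>j\<in>{1..n}. z i j \<in> {0, 1}" "lp_cost n a b z \<le> lp_cost n a b y" by blast
    define E where "E = {(i, j) \<in> {1..n} \<times> {1..n}. z i j = 1}"
    have eq: "ind E i j = z i j" if "i \<in> {1..n}" "j \<in> {1..n}" for i j
      using z(2) that by (force simp: ind_def E_def)
    have "lp_feasible n \<Delta> (ind E)" using z(1) lp_feasible_cong[of n "ind E" z \<Delta>] eq by blast
    moreover have "E \<subseteq> {1..n} \<times> {1..n}" by (auto simp: E_def)
    ultimately have "E \<in> S" by (simp add: S_def)
    moreover have "lp_cost n a b (ind E) \<le> lp_cost n a b y"
      using z(3) lp_cost_cong[of n "ind E" z a b] eq by simp
    ultimately show ?thesis by blast
  qed
  \<comment> \<open>The identity matrix has trace \<open>n\<close>, so it is feasible for every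
    \<Delta>.\<close>
  have "lp_feasible n \<Delta> (\<lambda>i j. if i = j then 1 else 0)"
    by (auto simp: lp_feasible_def)
  then have ne: "S \<noteq> {}" using below by blast
  define E where "E = arg_min_on (\<lambda>E. lp_cost n a b (ind E)) S"
  have E: "E \<in> S" "\<And>E'. E' \<in> S \<Longrightarrow> lp_cost n a b (ind E) \<le> lp_cost n a b (ind E')"
    unfolding E_def by (rule arg_min_if_finite(1)[OF fin ne], rule arg_min_least[OF fin ne])
  have "lp_optimal n \<Delta> a b (ind E)"
    unfolding lp_optimal_def
  proof (intro conjI allI impI)
    show "lp_feasible n \<Delta> (ind E)" using E(1) by (simp add: S_def)
  next
    fix y assume "lp_feasible n \<Delta> y"
    with below obtain E' where "E' \<in> S" "lp_cost n a b (ind E') \<le> lp_cost n a b y" by blast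
    then show "lp_cost n a b (ind E) \<le> lp_cost n a b y" using E(2) by (meson order_trans)
  qed
  then show ?thesis by (intro exI[of _ "ind E"]) (auto simp: ind_def)
qed

end
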